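(* Let $\mathcal{X}\subseteq\mathbb{R}^n\times\mathbb{R}^{m\times n}\times\mathbb{R}^m$ be a domain of LP problems that is feasibly convex, so that there are fixed $p\in\mathbb{R}^n$ and $A\in\mathbb{R}^{m\times n}$ with every element of $\mathcal{X}$ of the form $(p,A,b)$. Then the optimal value function $V$ on $\mathcal{X}$ is concave, i.e. for all $(p,A,b^{(1)}),(p,A,b^{(2)})\in\mathcal{X}$ and all $t\in[0,1]$, $$V(p,A,tb^{(1)}+(1-t)b^{(2)})\ \ge\ tV(p,A,b^{(1)})+(1-t)V(p,A,b^{(2)}).$$
   Context: Let $m,n$ be positive integers. An $m\times n$ LP problem is a triple $\xi=(p,A,b)\in\mathbb{R}^n\times\mathbb{R}^{m\times n}\times\mathbb{R}^m$, standing for: maximize $p^Tx$ subject to $Ax=b$, $x\ge 0$ (coordinatewise). Its feasible set is $X(\xi)=\{x\in\mathbb{R}^n_+ : Ax=b\}$ and its set of optimal solutions is $S(\xi)=\{x\in X(\xi): p^Tx\ge p^Tx' \text{ for all } x'\in X(\xi)\}$. A domain is a non-empty subset $\mathcal{X}$ of $\mathbb{R}^n\times\mathbb{R}^{m\times n}\times\mathbb{R}^m$ such that $S(\xi)\neq\emptyset$ for every $\xi\in\mathcal{X}$. The optimal value function $V:\mathcal{X}\to\mathbb{R}$ is $V(p,A,b)=p^Tx$ for any $x\in S(p,A,b)$. A domain $\mathcal{X}$ is feasibly convex if (i) there exist $A\in\mathbb{R}^{m\times n}$ and $p\in\mathbb{R}^n$ such that every $\xi\in\mathcal{X}$ has matrix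 component $A$ and objective component $p$; and (ii) whenever $(p,A,b^{(1)}),(p,A,b^{(2)})\in\mathcal{X}$ and $t\in[0,1]$, also $(p,A,tb^{(1)}+(1-t)b^{(2)})\in\mathcal{X}$. *)

theory Defs
  imports "HOL-Analysis.Analysis"
begin

text \<open>
  An LP problem with constraints indexed by \<open>'m\<close> and variables indexed by \<open>'n\<close> is a
  triple \<open>(p, A, b)\<close>, standing for: maximize \<open>p \<bullet> x\<close> subject to \<open>A *v x = b\<close> and \<open>x \<ge> 0\<close>.
\<close>

type_synonym ('m, 'n) lp = "(real ^ 'n) \<times> (real ^ 'n ^ 'm) \<times> (real ^ 'm)"

fun feasible_set :: "('m::finite, 'n::finite) lp \<Rightarrow> (real ^ 'n) set" where
  "feasible_set (p, A, b) = {x. (\<forall>j. 0 \<le> x $ j) \<and> A *v x = b}"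

fun optimal_set :: "('m::finite, 'n::finite) lp \<Rightarrow> (real ^ 'n) set" where
  "optimal_set (p, A, b) =
    {x \<in> feasible_set (p, A, b). \<forall>x' \<in> feasible_set (p, A, b). p \<bullet> x \<ge> p \<bullet> x'}"

definition lp_domain :: "('m::finite, 'n::finite) lp set \<Rightarrow> bool" where
  "lp_domain \<X> \<longleftrightarrow> \<X> \<noteq> {} \<and> (\<forall>\<xi> \<in> \<X>. optimal_set \<xi> \<noteq> {})"

text \<open>
  The objective takes the same value at all optimal solutions, so the description below is
  well-defined whenever the optimal set is non-empty, in particular on every domain.
  It is unspecified elsewhere.
\<close>

fun opt_value :: "('m::finite, 'n::finite) lp \<Rightarrow> real" where
  "opt_value (p, A, b) = (THE v. \<exists>x \<in> optimal_set (p, A, b). v = p \<bullet> x)"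

definition feasibly_convex :: "('m::finite, 'n::finite) lp set \<Rightarrow> bool" where
  "feasibly_convex \<X> \<longleftrightarrow>
    (\<exists>A p. (\<forall>\<xi> \<in> \<X>. fst \<xi> = p \<and> fst (snd \<xi>) = A) \<and>
      (\<forall>b1 b2. \<forall>t \<in> {0..1}. (p, A, b1) \<in> \<X> \<longrightarrow> (p, A, b2) \<in> \<X> \<longrightarrow>
        (p, A, t *\<^sub>R b1 + (1 - t) *\<^sub>R b2) \<in> \<X>))"

end

theory Submission
  imports Defs
begin

text \<open>Mixing an optimal solution for \<open>b1\<close> with one for \<open>b2\<close>, with
  weights \<open>t\<close> and \<open>1 - t\<close>, gives a feasible point for the mixed right-hand
  side, since the constraints are linear and the weights nonnegative
  (\<open>feasible_set_convex_combination\<close>). Its objective value is the same mixture of the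
  two optimal values, and the optimum of the mixed problem is at least that.\<close>

text \<open>Any two optimal solutions are feasible, so each bounds the other's objective value;
  hence the description in \<open>opt_value\<close> has exactly one candidate.\<close>

lemma opt_value_eq:
  assumes "x \<in> optimal_set (p, A, b)"
  shows "opt_value (p, A, b) = p \<bullet> x"
proof -
  have "p \<bullet> y = p \<bullet> x" if "y \<in> optimal_set (p, A, b)" for y
    using assms that by (intro antisym) auto
  then show ?thesis
    unfolding opt_value.simps using assms by (intro the_equality) blast+
qed

lemma feasible_set_convex_combination:
  assumes "x \<in> feasible_set (p, A, b1)" "y \<in> feasible_set (p, A, b2)" "t \<in> {0..1}"
  shows "t *\<^sub>R x + (1 - t) *\<^sub>R y \<in> feasible_set (p, A, t *\<^sub>R b1 + (1 - t) *\<^sub>R b2)"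
  using assms
  by (auto simp: matrix_vector_right_distrib scaleR_matrix_vector_assoc matrix_vector_mult_scaleR)

theorem proposition1:
  fixes \<X> :: "('m::finite, 'n::finite) lp set"
    and p :: "real ^ 'n" and A :: "real ^ 'n ^ 'm"
  assumes "lp_domain \<X>"
    and "feasibly_convex \<X>"
  shows "\<forall>b1 b2. \<forall>t \<in> {0..1}. (p, A, b1) \<in> \<X> \<longrightarrow> (p, A, b2) \<in> \<X> \<longrightarrow>
    opt_value (p, A, t *\<^sub>R b1 + (1 - t) *\<^sub>R b2)
      \<ge> t * opt_value (p, A, b1) + (1 - t) * opt_value (p, A, b2)"
proof (intro allI ballI impI)
  fix b1 b2 and t :: real
  assume t: "t \<in> {0..1}" and b1: "(p, A, b1) \<in> \<X>" and b2: "(p, A, b2) \<in> \<X>"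
  let ?b = "t *\<^sub>R b1 + (1 - t) *\<^sub>R b2"
  \<comment> \<open>The matrix and objective supplied by \<open>feasibly_convex\<close> must be the
    given \<open>A\<close> and \<open>p\<close>, because \<open>(p, A, b1)\<close> lies in the
    domain.\<close>
  have b: "(p, A, ?b) \<in> \<X>"
    using assms(2) t b1 b2 unfolding feasibly_convex_def by fastforce
  \<comment> \<open>\<open>z\<close> exists because the mixed problem also lies in the domain, so
    its optimum is attained.\<close>
  obtain x y z where opt: "x \<in> optimal_set (p, A, b1)" "y \<in> optimal_set (p, A, b2)"
      "z \<in> optimal_set (p, A, ?b)"
    using assms(1) b1 b2 b unfolding lp_domain_def by blast
  then have "t *\<^sub>R x + (1 - t) *\<^sub>R y \<in> feasible_set (p, A, ?b)"
    using t by (intro feasible_set_convex_combination) auto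
  then have "p \<bullet> (t *\<^sub>R x + (1 - t) *\<^sub>R y) \<le> p \<bullet> z"
    using opt(3) by simp
  then show "opt_value (p, A, ?b) \<ge> t * opt_value (p, A, b1) + (1 - t) * opt_value (p, A, b2)"
    by (simp only: opt[THEN opt_value_eq] inner_add_right inner_scaleR_right)
qed

end
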